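(* Let $\mathbb{V}$ be any vector space (finite or infinite dimensional) over the field $\mathbb{F}_2$ and $\mathcal{K}=\{+\}\cup\{f_r:r\in\mathbb{F}_2,r\neq0\}$, where $f_r(v)=r\cdot v$. Then $(\mathbb{V},\mathcal{K})$ is a Ramsey algebra.
   Context: $\mathbb{F}_2$ is the two-element field. Orderly terms $\mathrm{OT}(\mathcal{K})$: smallest collection containing $\mathcal{K}$ and $\mathrm{id}_\mathbb{V}$, closed under $f(\bar x_1,\dots,\bar x_k)=g(h_1(\bar x_1),\dots,h_k(\bar x_k))$ for $k$-ary $g\in\mathcal{K}$, orderly terms $h_i$, consecutive disjoint variable blocks $\bar x_i$. For $\vec a,\vec b\in{}^\omega\mathbb{V}$, $\vec a\le_\mathcal{K}\vec b$ means there are orderly terms $f_j$ and finite subsequences $\vec b_j$ of $\vec b$ with $\vec a(j)=f_j(\bar b_j)$ for all $j\in\omega$ and $\vec b_0\ast\vec b_1\ast\cdots$ a subsequence of $\vec b$. $\mathrm{FR}_\mathcal{K}(\vec a)=\{f(\bar\tau):f\in\mathrm{OT}(\mathcal{K}),\ \vec\tau\text{ a finite subsequence of }\vec a\}$. $(\mathbb{V},\mathcal{K})$ is a Ramsey algebra if for every $\vec b\in{}^\omega\mathbb{V}$ and $X\subseteq\mathbb{V}$ there exists $\vec a\le_\mathcal{K}\vec b$ with $\mathrm{FR}_\mathcal{K}(\vec a)\subseteq X$ or $\mathrm{FR}_\mathcal{K}(\vec a)\cap X=\varnothing$. *)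

theory Defs
  imports Complex_Main "HOL-Library.Z2"
begin

(* (n, f) stands for an n-ary operation on 'v.  Arguments are passed as a list, and f is only
   ever evaluated on lists of length n; its values on other lists are irrelevant. *)
type_synonym 'v operation = "nat \<times> ('v list \<Rightarrow> 'v)"

(* Cuts the argument list into consecutive blocks, one for each operation in the list (of length
   its arity), and applies each operation to its block. *)
fun apply_blocks :: "'v operation list \<Rightarrow> 'v list \<Rightarrow> 'v list" where
  "apply_blocks [] xs = []"
| "apply_blocks ((n, h) # hs) xs = h (take n xs) # apply_blocks hs (drop n xs)"

inductive_set orderly_terms :: "'v operation set \<Rightarrow> 'v operation set"
  for K :: "'v operation set" where
  basic: "p \<in> K \<Longrightarrow> p \<in> orderly_terms K"
| ident: "(1, \<lambda>xs. xs ! 0) \<in> orderly_terms K"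
| comp: "(k, g) \<in> K \<Longrightarrow> length hs = k \<Longrightarrow> \<forall>h\<in>set hs. h \<in> orderly_terms K \<Longrightarrow>
    (sum_list (map fst hs), \<lambda>xs. g (apply_blocks hs xs)) \<in> orderly_terms K"

definition finite_subseq :: "'v list \<Rightarrow> (nat \<Rightarrow> 'v) \<Rightarrow> bool" where
  "finite_subseq xs b \<longleftrightarrow> (\<exists>ks :: nat list. sorted_wrt (<) ks \<and> xs = map b ks)"

(* bs 0 * bs 1 * bs 2 * ... is a subsequence of b: in the concatenation, the list bs j occupies
   the positions s j, ..., s (Suc j) - 1, where s j is the total length of the lists before it. *)
definition concat_subseq :: "(nat \<Rightarrow> 'v list) \<Rightarrow> (nat \<Rightarrow> 'v) \<Rightarrow> bool" where
  "concat_subseq bs b \<longleftrightarrow>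
    (\<exists>\<phi> :: nat \<Rightarrow> nat. strict_mono \<phi> \<and>
      (\<forall>j. \<forall>i < length (bs j). bs j ! i = b (\<phi> ((\<Sum>l<j. length (bs l)) + i))))"

definition reduction :: "'v operation set \<Rightarrow> (nat \<Rightarrow> 'v) \<Rightarrow> (nat \<Rightarrow> 'v) \<Rightarrow> bool" where
  "reduction K a b \<longleftrightarrow>
    (\<exists>(n :: nat \<Rightarrow> nat) (f :: nat \<Rightarrow> 'v list \<Rightarrow> 'v) (bs :: nat \<Rightarrow> 'v list).
      (\<forall>j. (n j, f j) \<in> orderly_terms K \<and> finite_subseq (bs j) b \<and>
           length (bs j) = n j \<and> a j = f j (bs j)) \<and>
      concat_subseq bs b)"

definition FR :: "'v operation set \<Rightarrow> (nat \<Rightarrow> 'v) \<Rightarrow> 'v set" where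
  "FR K a = {f ts | n f ts. (n, f) \<in> orderly_terms K \<and> finite_subseq ts a \<and> length ts = n}"

(* The underlying set of the algebra is the whole type 'v. *)
definition ramsey_algebra :: "'v operation set \<Rightarrow> bool" where
  "ramsey_algebra K \<longleftrightarrow>
    (\<forall>(b :: nat \<Rightarrow> 'v) (X :: 'v set). \<exists>a. reduction K a b \<and> (FR K a \<subseteq> X \<or> FR K a \<inter> X = {}))"

definition vector_space_ops :: "('k::field \<Rightarrow> 'v::ab_group_add \<Rightarrow> 'v) \<Rightarrow> 'v operation set" where
  "vector_space_ops scale =
    {(2, \<lambda>xs. xs ! 0 + xs ! 1)} \<union> {(1, \<lambda>xs. scale r (xs ! 0)) | r. r \<noteq> 0}"

end

theory Submission
  imports Defs "HOL-Library.Infinite_Set"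
begin

text \<open>
  On argument lists of the right length every orderly term is a nonempty sum, since the only
  nonzero scalar of the two-element field is 1. The claim thus reduces to Hindman's theorem on
  finite unions, applied to the finite sets \<open>S\<close> of indices whose sum \<open>\<Sum>i\<in>S. b i\<close> lies in \<open>X\<close>.
  Hindman's theorem is proved following Baumgartner: call \<open>X\<close> large for a block sequence \<open>F\<close> if it
  meets the finite unions of every block sequence refining \<open>F\<close>. If \<open>X\<close> is large for \<open>F\<close> then for
  some union \<open>e\<close> of blocks the set \<open>{x \<in> X. x \<union> e \<in> X}\<close> is large for a refinement of \<open>F\<close>;
  iterating this produces a refinement with all finite unions in \<open>X\<close>.
\<close>

section \<open>Block sequences\<close>

text \<open>Comparing neighbours only is enough: blocks are nonempty, so the order passes along the
  chain (\<open>blocks_less\<close>).\<close>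

definition blocks :: "(nat \<Rightarrow> nat set) \<Rightarrow> bool" where
  "blocks F \<longleftrightarrow> (\<forall>j. finite (F j) \<and> F j \<noteq> {} \<and> (\<forall>x\<in>F j. \<forall>y\<in>F (Suc j). x < y))"

definition FU :: "(nat \<Rightarrow> nat set) \<Rightarrow> nat set set" where
  "FU F = {\<Union>(F ` S) | S. finite S \<and> S \<noteq> {}}"

definition refines :: "(nat \<Rightarrow> nat set) \<Rightarrow> (nat \<Rightarrow> nat set) \<Rightarrow> bool" where
  "refines G F \<longleftrightarrow> blocks G \<and> range G \<subseteq> FU F"

definition large :: "nat set set \<Rightarrow> (nat \<Rightarrow> nat set) \<Rightarrow> bool" where
  "large X F \<longleftrightarrow> (\<forall>G. refines G F \<longrightarrow> FU G \<inter> X \<noteq> {})"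

lemma FU_I: "finite S \<Longrightarrow> S \<noteq> {} \<Longrightarrow> \<Union>(F ` S) \<in> FU F"
  by (auto simp: FU_def)

lemma FU_E:
  assumes "x \<in> FU F"
  obtains S where "finite S" "S \<noteq> {}" "x = \<Union>(F ` S)"
  using assms by (auto simp: FU_def)

lemma FU_component: "F j \<in> FU F"
  using FU_I[of "{j}" F] by simp

lemma FU_Un:
  assumes "x \<in> FU F" "y \<in> FU F"
  shows "x \<union> y \<in> FU F"
proof -
  obtain S where S: "finite S" "S \<noteq> {}" "x = \<Union>(F ` S)" using assms(1) by (rule FU_E)
  obtain T where T: "finite T" "T \<noteq> {}" "y = \<Union>(F ` T)" using assms(2) by (rule FU_E)
  have "x \<union> y = \<Union>(F ` (S \<union> T))" using S T by auto
  then show ?thesis using FU_I[of "S \<union> T" F] S T by simp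
qed

lemma FU_UN:
  assumes "finite S" "S \<noteq> {}" "\<And>i. i \<in> S \<Longrightarrow> G i \<in> FU F"
  shows "\<Union>(G ` S) \<in> FU F"
  using assms by (induction S rule: finite_ne_induct) (auto intro: FU_Un)

lemma refines_FU_subset: "refines G F \<Longrightarrow> FU G \<subseteq> FU F"
  by (auto simp: refines_def elim!: FU_E intro!: FU_UN)

lemma blocks_finite: "blocks F \<Longrightarrow> finite (F j)"
  and blocks_nonempty: "blocks F \<Longrightarrow> F j \<noteq> {}"
  by (auto simp: blocks_def)

lemma blocks_less:
  assumes "blocks F" "i < j" "x \<in> F i" "y \<in> F j"
  shows "x < y"
  using assms(2,4)
proof (induction j arbitrary: y)
  case (Suc j)
  show ?case
  proof (cases "i = j")
    case True
    then show ?thesis using assms(1,3) Suc.prems by (auto simp: blocks_def)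
  next
    case False
    obtain z where z: "z \<in> F j" using blocks_nonempty[OF assms(1)] by auto
    then have "x < z" using Suc False by auto
    moreover have "z < y" using assms(1) z Suc.prems by (auto simp: blocks_def)
    ultimately show ?thesis by simp
  qed
qed simp

lemma blocks_disjoint: "blocks F \<Longrightarrow> i \<noteq> j \<Longrightarrow> F i \<inter> F j = {}"
  using blocks_less[of F] by (metis disjoint_iff less_irrefl nat_neq_iff)

lemma blocks_ge: "blocks F \<Longrightarrow> x \<in> F j \<Longrightarrow> j \<le> x"
proof (induction j arbitrary: x)
  case (Suc j)
  obtain z where z: "z \<in> F j" using blocks_nonempty[OF Suc.prems(1)] by auto
  then have "j \<le> z" using Suc by auto
  moreover have "z < x" using Suc.prems z by (auto simp: blocks_def)
  ultimately show ?case by simp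
qed simp

lemma finite_FU: "blocks F \<Longrightarrow> x \<in> FU F \<Longrightarrow> finite x"
  by (auto elim!: FU_E simp: blocks_finite)

lemma FU_nonempty: "blocks F \<Longrightarrow> x \<in> FU F \<Longrightarrow> x \<noteq> {}"
  by (auto elim!: FU_E simp: blocks_nonempty)

lemma refines_refl: "blocks F \<Longrightarrow> refines F F"
  by (auto simp: refines_def FU_component)

lemma refines_trans: "refines G F \<Longrightarrow> refines H G \<Longrightarrow> refines H F"
  using refines_FU_subset[of G F] unfolding refines_def by blast

lemma refines_shift: "blocks F \<Longrightarrow> refines (\<lambda>j. F (j + n)) F"
  by (auto simp: refines_def FU_component blocks_def)

lemma large_refines: "large X F \<Longrightarrow> refines G F \<Longrightarrow> large X G"
  using refines_trans by (auto simp: large_def)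

lemma blocks_UN:
  assumes "blocks e" "blocks H"
  shows "blocks (\<lambda>k. \<Union>(e ` H k))"
  unfolding blocks_def
proof (intro allI conjI ballI)
  fix j x y
  show "finite (\<Union>(e ` H j))" using assms by (auto simp: blocks_finite)
  show "\<Union>(e ` H j) \<noteq> {}" using assms by (auto simp: blocks_nonempty)
  assume "x \<in> \<Union>(e ` H j)" "y \<in> \<Union>(e ` H (Suc j))"
  then obtain p q where "p \<in> H j" "x \<in> e p" "q \<in> H (Suc j)" "y \<in> e q" by blast
  then show "x < y"
    using blocks_less[OF assms(2), of j "Suc j" p q] blocks_less[OF assms(1), of p q] by simp
qed

text \<open>Each set is chosen beyond a bound \<open>N k\<close> that exceeds every element chosen
  before. As \<open>P\<close> may depend on this bound, a new block can be made to fit all unions of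
  earlier ones at once.\<close>

lemma greedy_blocks:
  fixes P :: "nat \<Rightarrow> nat set \<Rightarrow> bool"
  assumes "\<And>n. \<exists>S. finite S \<and> S \<noteq> {} \<and> S \<subseteq> {n..} \<and> P n S"
  obtains G N where "blocks G" "\<And>k. P (N k) (G k)" "\<And>i k. i < k \<Longrightarrow> G i \<subseteq> {..<N k}"
proof -
  obtain g where g: "\<And>n. finite (g n) \<and> g n \<noteq> {} \<and> g n \<subseteq> {n..} \<and> P n (g n)"
    using assms by metis
  define N where "N = rec_nat 0 (\<lambda>_ n. Suc (Max (g n)))"
  have N_Suc: "N (Suc k) = Suc (Max (g (N k)))" for k by (simp add: N_def)
  have below: "g (N k) \<subseteq> {..<N (Suc k)}" for k
    using g[of "N k"] by (auto simp: N_Suc less_Suc_eq_le)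
  have "N k \<le> N (Suc k)" for k
    using g[of "N k"] below[of k] by (force simp: subset_iff)
  then have N_mono: "i \<le> k \<Longrightarrow> N i \<le> N k" for i k
    by (rule lift_Suc_mono_le)
  show ?thesis
  proof
    show "blocks (\<lambda>k. g (N k))"
      unfolding blocks_def
    proof (intro allI conjI ballI)
      fix j x y
      assume "x \<in> g (N j)" "y \<in> g (N (Suc j))"
      then show "x < y" using below[of j] g[of "N (Suc j)"] by fastforce
    qed (use g in auto)
    show "P (N k) (g (N k))" for k using g by simp
    show "g (N i) \<subseteq> {..<N k}" if "i < k" for i k
      using below[of i] N_mono[of "Suc i" k] that by (auto simp: subset_iff)
  qed
qed

section \<open>Hindman's theorem on finite unions\<close>

text \<open>If no \<open>N\<close> worked, there would be arbitrarily late \<open>d\<close> whose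
  unions with all earlier members of \<open>FU F\<close> avoid \<open>X\<close>. Chaining such sets
  yields a refinement with every finite union outside \<open>X\<close>, against largeness.\<close>

lemma large_absorbs:
  assumes "blocks F" "large X F"
  shows "\<exists>N. \<forall>d\<in>FU F. d \<subseteq> {N..} \<longrightarrow> (\<exists>e\<in>FU F. e \<subseteq> {..<N} \<and> d \<union> e \<in> X)"
proof (rule ccontr)
  assume "\<not> ?thesis"
  then have neg: "\<And>N. \<exists>d\<in>FU F. d \<subseteq> {N..} \<and> (\<forall>e\<in>FU F. e \<subseteq> {..<N} \<longrightarrow> d \<union> e \<notin> X)"
    by metis
  define P where
    "P n S \<longleftrightarrow> S \<in> FU F \<and> (\<forall>e\<in>insert {} (FU F). e \<subseteq> {..<n} \<longrightarrow> S \<union> e \<notin> X)" for n S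
  have "\<exists>S. finite S \<and> S \<noteq> {} \<and> S \<subseteq> {n..} \<and> P n S" for n
  proof -
    \<comment> \<open>The failing \<open>d\<close> is taken beyond \<open>F n\<close> and joined
      with it. Even for empty \<open>e\<close>, the set \<open>F n \<union> e\<close> is a member of
      \<open>FU F\<close> below \<open>m\<close>, so the choice of \<open>d\<close> covers that case
      too.\<close>
    define m where "m = Suc (Max (F n))"
    have Fn: "F n \<subseteq> {n..}" "F n \<subseteq> {..<m}"
      using blocks_ge[OF assms(1)] blocks_finite[OF assms(1)] by (auto simp: m_def less_Suc_eq_le)
    then have nm: "n \<le> m" using blocks_nonempty[OF assms(1), of n] by fastforce
    obtain d where d: "d \<in> FU F" "d \<subseteq> {m..}" "\<And>e. e \<in> FU F \<Longrightarrow> e \<subseteq> {..<m} \<Longrightarrow> d \<union> e \<notin> X"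
      using neg by meson
    have FUd: "d \<union> F n \<in> FU F" using d FU_Un FU_component by blast
    have "(d \<union> F n) \<union> e \<notin> X" if e: "e \<in> insert {} (FU F)" "e \<subseteq> {..<n}" for e
    proof -
      have "F n \<union> e \<in> FU F" using e FU_Un[of "F n" F e] FU_component[of F n] by auto
      moreover have "F n \<union> e \<subseteq> {..<m}" using Fn e nm by auto
      ultimately show ?thesis using d(3) by (metis Un_assoc)
    qed
    then have "P n (d \<union> F n)" using FUd by (simp add: P_def)
    moreover have "d \<union> F n \<subseteq> {n..}" using d Fn nm by auto
    moreover have "finite (d \<union> F n)" "d \<union> F n \<noteq> {}"
      using finite_FU[OF assms(1) FUd] FU_nonempty[OF assms(1) FUd] by auto
    ultimately show ?thesis by blast
  qed
  then obtain G N where G: "blocks G" "\<And>k. P (N k) (G k)" "\<And>i k. i < k \<Longrightarrow> G i \<subseteq> {..<N k}"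
    by (rule greedy_blocks) auto
  have GF: "G k \<in> FU F" for k using G(2) by (simp add: P_def)
  have "refines G F" using G(1) GF by (auto simp: refines_def)
  then obtain x where x: "x \<in> FU G" "x \<in> X" using assms(2) by (auto simp: large_def)
  obtain S where S: "finite S" "S \<noteq> {}" "x = \<Union>(G ` S)" using x(1) by (rule FU_E)
  \<comment> \<open>The last block \<open>G m\<close> carries the property \<open>P\<close>; the
    union of the others, possibly empty, lies below \<open>N m\<close> and takes the place of
    \<open>e\<close>.\<close>
  define m where "m = Max S"
  have m: "m \<in> S" "\<And>i. i \<in> S - {m} \<Longrightarrow> i < m"
    using S Max_ge[of S] by (auto simp: m_def order.strict_iff_order)
  let ?e = "\<Union>(G ` (S - {m}))"
  have "?e \<in> insert {} (FU F)"
  proof (cases "S - {m} = {}")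
    case True
    then show ?thesis by (metis SUP_empty insertI1)
  next
    case False
    then show ?thesis using FU_UN[of "S - {m}" G F] S GF by simp
  qed
  moreover have "?e \<subseteq> {..<N m}" using m G(3) by blast
  ultimately have "G m \<union> ?e \<notin> X" using G(2)[of m] unfolding P_def by blast
  moreover have "x = G m \<union> ?e" using S m(1) by auto
  ultimately show False using x by simp
qed

text \<open>Largeness is partition regular: either \<open>Y e\<close> is large for \<open>F\<close>
  itself, or some refinement misses \<open>Y e\<close> completely, and there the remaining sets
  still cover. An empty cover is impossible, since \<open>F\<close> refines itself.\<close>

lemma large_finite_cover:
  assumes "finite E" "blocks F" "large X F" "X \<inter> FU F \<subseteq> (\<Union>e\<in>E. Y e)"
  shows "\<exists>e\<in>E. \<exists>G. refines G F \<and> large (Y e) G"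
  using assms
proof (induction E arbitrary: F rule: finite_induct)
  case empty
  then show ?case using refines_refl by (force simp: large_def)
next
  case (insert e E)
  show ?case
  proof (cases "large (Y e) F")
    case True
    then show ?thesis using refines_refl insert.prems(1) by auto
  next
    case False
    then obtain G where G: "refines G F" "FU G \<inter> Y e = {}" by (auto simp: large_def)
    have "X \<inter> FU G \<subseteq> (\<Union>e\<in>E. Y e)" using refines_FU_subset[OF G(1)] G(2) insert.prems(3) by auto
    then obtain e' H where "e' \<in> E" "refines H G" "large (Y e') H"
      using insert.IH[of G] G(1) large_refines[OF insert.prems(2) G(1)] by (auto simp: refines_def)
    then show ?thesis using refines_trans[OF G(1)] by blast
  qed
qed

text \<open>Beyond the bound \<open>N\<close> of \<open>large_absorbs\<close>, each member of
  \<open>X\<close> is absorbed by one of the finitely many \<open>e\<close> below \<open>N\<close>.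
  These \<open>e\<close> thus index a finite cover, and \<open>large_finite_cover\<close> selects
  one of them.\<close>

lemma large_step:
  assumes "blocks F" "large X F"
  obtains e G where "e \<in> FU F" "refines G F" "\<And>x j. x \<in> e \<Longrightarrow> \<forall>y\<in>G j. x < y"
    "large {x \<in> X. x \<union> e \<in> X} G"
proof -
  obtain N where N: "\<And>d. d \<in> FU F \<Longrightarrow> d \<subseteq> {N..} \<Longrightarrow> \<exists>e\<in>FU F. e \<subseteq> {..<N} \<and> d \<union> e \<in> X"
    using large_absorbs[OF assms] by blast
  \<comment> \<open>Dropping the first \<open>N\<close> blocks leaves only numbers at least
    \<open>N\<close>, because of \<open>blocks_ge\<close>.\<close>
  define F' where "F' = (\<lambda>j. F (j + N))"
  define E where "E = {e \<in> FU F. e \<subseteq> {..<N}}"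
  have "finite E" unfolding E_def by (rule finite_subset[of _ "Pow {..<N}"]) auto
  have F': "refines F' F" unfolding F'_def by (rule refines_shift[OF assms(1)])
  have tail: "d \<subseteq> {N..}" if "d \<in> FU F'" for d
    using that blocks_ge[OF assms(1)] by (fastforce simp: F'_def elim!: FU_E)
  have "X \<inter> FU F' \<subseteq> (\<Union>e\<in>E. {x \<in> X. x \<union> e \<in> X})"
    using N tail refines_FU_subset[OF F'] by (fastforce simp: E_def)
  then obtain e G where eG: "e \<in> E" "refines G F'" "large {x \<in> X. x \<union> e \<in> X} G"
    using large_finite_cover[OF \<open>finite E\<close> _ large_refines[OF assms(2) F'],
        of "\<lambda>e. {x \<in> X. x \<union> e \<in> X}"] F'
    by (auto simp: refines_def)
  show thesis
  proof
    show "e \<in> FU F" using eG by (simp add: E_def)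
    show "refines G F" using refines_trans[OF F' eG(2)] .
    show "\<forall>y\<in>G j. x < y" if "x \<in> e" for x j
    proof -
      have "G j \<in> FU F'" using eG(2) by (auto simp: refines_def)
      then show ?thesis using tail eG(1) that by (fastforce simp: E_def)
    qed
  qed (rule eG(3))
qed

text \<open>Iterating \<open>large_step\<close> gives blocks \<open>e n\<close> and shrinking sets
  \<open>A n\<close>. The \<open>e n\<close> themselves are not known to lie in \<open>A n\<close>,
  so a second greedy pass selects unions of them that do.\<close>

lemma large_contains_FU:
  assumes "blocks F" "large X F"
  shows "\<exists>G. blocks G \<and> FU G \<subseteq> X"
proof -
  define step where "step s t \<longleftrightarrow> (\<exists>e. e \<in> FU (snd s) \<and> refines (snd t) (snd s) \<and>
      (\<forall>x\<in>e. \<forall>j. \<forall>y\<in>snd t j. x < y) \<and> fst t = {x \<in> fst s. x \<union> e \<in> fst s})"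
    for s t :: "nat set set \<times> (nat \<Rightarrow> nat set)"
  \<comment> \<open>A state pairs the current set with the current block sequence. The clause for
    \<open>n = 0\<close> makes the iteration start from \<open>X\<close>.\<close>
  define good where "good n s \<longleftrightarrow> blocks (snd s) \<and> large (fst s) (snd s) \<and> (n = 0 \<longrightarrow> fst s = X)"
    for n :: nat and s :: "nat set set \<times> (nat \<Rightarrow> nat set)"
  have "\<exists>s. \<forall>n. good n (s n) \<and> step (s n) (s (Suc n))"
  proof (rule dependent_nat_choice)
    show "\<exists>s. good 0 s" using assms by (auto simp: good_def)
    fix s n
    assume "good n s"
    then obtain e G where "e \<in> FU (snd s)" "refines G (snd s)" "\<And>x j. x \<in> e \<Longrightarrow> \<forall>y\<in>G j. x < y"
      "large {x \<in> fst s. x \<union> e \<in> fst s} G"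
      using large_step[of "snd s" "fst s"] by (auto simp: good_def)
    then show "\<exists>t. good (Suc n) t \<and> step s t"
      by (intro exI[of _ "({x \<in> fst s. x \<union> e \<in> fst s}, G)"])
        (auto simp: good_def step_def refines_def)
  qed
  then obtain s where s: "\<And>n. good n (s n)" "\<And>n. step (s n) (s (Suc n))" by blast
  define A where "A n = fst (s n)" for n
  define B where "B n = snd (s n)" for n
  have A0: "A 0 = X" and B: "\<And>n. blocks (B n)" "\<And>n. large (A n) (B n)"
    using s(1) by (auto simp: good_def A_def B_def)
  obtain e where e: "\<And>n. e n \<in> FU (B n)" "\<And>n. refines (B (Suc n)) (B n)"
    "\<And>n x j y. x \<in> e n \<Longrightarrow> y \<in> B (Suc n) j \<Longrightarrow> x < y"
    "\<And>n. A (Suc n) = {x \<in> A n. x \<union> e n \<in> A n}"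
    using s(2) unfolding step_def A_def[symmetric] B_def[symmetric] by metis
  have blocks_e: "blocks e"
    unfolding blocks_def
  proof (intro allI conjI ballI)
    fix j x y
    show "finite (e j)" "e j \<noteq> {}" using finite_FU FU_nonempty B(1) e(1) by blast+
    assume "x \<in> e j" "y \<in> e (Suc j)"
    then show "x < y" using e(1)[of "Suc j"] e(3)[of x j y] by (auto elim!: FU_E)
  qed
  have "FU (B (Suc n)) \<subseteq> FU (B n)" for n using e(2) by (rule refines_FU_subset)
  then have B_anti: "n \<le> m \<Longrightarrow> FU (B m) \<subseteq> FU (B n)" for n m
    by (rule lift_Suc_antimono_le)
  \<comment> \<open>Membership in \<open>A (Suc n)\<close> puts both \<open>x\<close> and
    \<open>x \<union> e n\<close> into \<open>A n\<close>, so the index \<open>n\<close> can be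
    removed from \<open>T\<close> whether or not it occurs there.\<close>
  have absorb: "x \<union> \<Union>(e ` T) \<in> X" if "x \<in> A n" "T \<subseteq> {..<n}" for x n T
    using that
  proof (induction n arbitrary: x T)
    case 0
    then show ?case using A0 by simp
  next
    case (Suc n)
    have T: "T - {n} \<subseteq> {..<n}" using Suc.prems by (auto simp: less_Suc_eq)
    have "x \<in> A n" "x \<union> e n \<in> A n" using Suc.prems e(4) by auto
    then have IH: "x \<union> \<Union>(e ` (T - {n})) \<in> X" "(x \<union> e n) \<union> \<Union>(e ` (T - {n})) \<in> X"
      using Suc.IH T by blast+
    show ?case
    proof (cases "n \<in> T")
      case True
      then have "x \<union> \<Union>(e ` T) = (x \<union> e n) \<union> \<Union>(e ` (T - {n}))" by auto
      then show ?thesis using IH by simp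
    next
      case False
      then show ?thesis using IH by simp
    qed
  qed
  \<comment> \<open>The tail of \<open>e\<close> starting at \<open>n\<close> refines
    \<open>B n\<close>, for which \<open>A n\<close> is large.\<close>
  have "\<exists>S. finite S \<and> S \<noteq> {} \<and> S \<subseteq> {n..} \<and> \<Union>(e ` S) \<in> A n" for n
  proof -
    have "e (j + n) \<in> FU (B n)" for j
      using e(1)[of "j + n"] B_anti[of n "j + n"] by auto
    then have "refines (\<lambda>j. e (j + n)) (B n)"
      using refines_shift[OF blocks_e, of n] by (auto simp: refines_def)
    then obtain x where x: "x \<in> FU (\<lambda>j. e (j + n))" "x \<in> A n" using B(2) by (auto simp: large_def)
    then obtain S where "finite S" "S \<noteq> {}" "x = (\<Union>j\<in>S. e (j + n))" by (auto elim: FU_E)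
    then show ?thesis using x(2)
      by (intro exI[of _ "(\<lambda>j. j + n) ` S"]) (auto simp: image_image)
  qed
  \<comment> \<open>The \<open>H k\<close> are blocks of indices into \<open>e\<close>. Those before
    \<open>H k\<close> lie below \<open>N k\<close>, so \<open>absorb\<close> allows their unions to
    be joined to the one from \<open>H k\<close>.\<close>
  then obtain H N where H: "blocks H" "\<And>k. \<Union>(e ` H k) \<in> A (N k)" "\<And>i k. i < k \<Longrightarrow> H i \<subseteq> {..<N k}"
    by (rule greedy_blocks) auto
  define G where "G k = \<Union>(e ` H k)" for k
  have "x \<in> X" if x: "x \<in> FU G" for x
  proof -
    obtain S where S: "finite S" "S \<noteq> {}" "x = \<Union>(G ` S)" using x by (rule FU_E)
    define m where "m = Max S"
    have m: "m \<in> S" "\<And>i. i \<in> S - {m} \<Longrightarrow> i < m"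
      using S Max_ge[of S] by (auto simp: m_def order.strict_iff_order)
    let ?T = "\<Union>(H ` (S - {m}))"
    have "?T \<subseteq> {..<N m}" using m H(3) by blast
    then have "G m \<union> \<Union>(e ` ?T) \<in> X" using absorb[OF H(2)] unfolding G_def by blast
    moreover have "x = G m \<union> \<Union>(e ` ?T)" using S m(1) by (auto simp: G_def)
    ultimately show ?thesis by simp
  qed
  moreover have "blocks G" unfolding G_def using blocks_e H(1) by (rule blocks_UN)
  ultimately show ?thesis by blast
qed

text \<open>The case split is largeness for the singletons: its failure is, by definition, a block
  sequence whose finite unions avoid \<open>X\<close>.\<close>

theorem Hindman_finite_unions: "\<exists>G. blocks G \<and> (FU G \<subseteq> X \<or> FU G \<inter> X = {})"
proof (cases "large X (\<lambda>j. {j})")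
  case True
  have "blocks (\<lambda>j. {j})" by (simp add: blocks_def)
  then show ?thesis using large_contains_FU True by blast
next
  case False
  then show ?thesis by (auto simp: large_def refines_def)
qed

section \<open>Orderly terms over the two-element field\<close>

lemma bit_nonzero_eq_1: "(r :: bit) \<noteq> 0 \<Longrightarrow> r = 1"
  by (cases r) auto

text \<open>The bound on the arity excludes the empty sum, which would correspond to the empty
  union, absent from \<open>FU\<close>.\<close>

lemma orderly_term_sum_list:
  fixes scale :: "bit \<Rightarrow> 'v::ab_group_add \<Rightarrow> 'v"
  assumes "vector_space scale" "p \<in> orderly_terms (vector_space_ops scale)"
  shows "fst p \<ge> 1 \<and> (\<forall>xs. length xs = fst p \<longrightarrow> snd p xs = sum_list xs)"
proof -
  have ops: "fst q \<ge> 1 \<and> (\<forall>xs. length xs = fst q \<longrightarrow> snd q xs = sum_list xs)"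
    if "q \<in> vector_space_ops scale" for q
  proof -
    have "scale 1 v = v" for v using assms(1) by (simp add: vector_space_def)
    then show ?thesis
      using that by (auto simp: vector_space_ops_def length_Suc_conv numeral_2_eq_2
          dest!: bit_nonzero_eq_1)
  qed
  have apply_blocks: "length (apply_blocks hs xs) = length hs \<and>
      sum_list (apply_blocks hs xs) = sum_list xs"
    if "\<forall>h\<in>set hs. \<forall>xs. length xs = fst h \<longrightarrow> snd h xs = sum_list xs"
      "length xs = sum_list (map fst hs)"
    for hs :: "'v operation list" and xs
    using that
  proof (induction hs arbitrary: xs)
    case (Cons h hs)
    have "sum_list xs = sum_list (take (fst h) xs) + sum_list (drop (fst h) xs)"
      by (metis append_take_drop_id sum_list_append)
    then show ?case using Cons by (cases h) auto
  qed simp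
  show ?thesis using assms(2)
  proof (induction rule: orderly_terms.induct)
    case (basic p)
    then show ?case by (rule ops)
  next
    case ident
    then show ?case by (auto simp: length_Suc_conv)
  next
    case (comp k g hs)
    \<comment> \<open>A positive outer arity forces at least one inner term, whose own positive
      arity bounds the total from below.\<close>
    have "k \<ge> 1" using ops[OF comp(1)] by simp
    then obtain h hs' where hs: "hs = h # hs'" using comp(2) by (cases hs) auto
    then have "sum_list (map fst hs) \<ge> 1" using comp(3) by auto
    moreover have "g (apply_blocks hs xs) = sum_list xs" if "length xs = sum_list (map fst hs)" for xs
      using ops[OF comp(1)] apply_blocks[of hs xs] that comp(2,3) by auto
    ultimately show ?case by simp
  qed
qed

text \<open>Supplies a term for a block of any positive size, by nesting addition to the right with
  the identity as left argument.\<close>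

lemma orderly_term_exists:
  fixes scale :: "bit \<Rightarrow> 'v::ab_group_add \<Rightarrow> 'v"
  shows "\<exists>f. (Suc n, f) \<in> orderly_terms (vector_space_ops scale)"
proof (induction n)
  case 0
  show ?case using orderly_terms.ident by auto
next
  case (Suc n)
  then obtain f where f: "(Suc n, f) \<in> orderly_terms (vector_space_ops scale)" by blast
  have "(2, \<lambda>xs. xs ! 0 + xs ! 1) \<in> vector_space_ops scale" by (simp add: vector_space_ops_def)
  from orderly_terms.comp[OF this, of "[(1, \<lambda>xs. xs ! 0), (Suc n, f)]"]
  show ?case using f orderly_terms.ident[of "vector_space_ops scale"] by auto
qed

section \<open>Concatenating the blocks\<close>

text \<open>Turns positions into cardinalities: the elements below the \<open>n\<close>-th one are
  the values at the indices below \<open>n\<close>.\<close>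

lemma enumerate_card_less:
  fixes U :: "nat set"
  assumes "infinite U" "x \<in> U"
  shows "enumerate U (card {y \<in> U. y < x}) = x"
proof -
  obtain n where n: "enumerate U n = x" using enumerate_Ex[OF assms] by blast
  have "{y \<in> U. y < x} = enumerate U ` {..<n}"
  proof (intro set_eqI iffI)
    fix y assume "y \<in> {y \<in> U. y < x}"
    then show "y \<in> enumerate U ` {..<n}"
      using enumerate_Ex[OF assms(1), of y] enumerate_mono_iff[OF assms(1)] n by auto
  next
    fix y assume "y \<in> enumerate U ` {..<n}"
    then show "y \<in> {y \<in> U. y < x}"
      using enumerate_in_set[OF assms(1)] enumerate_mono_iff[OF assms(1)] n by auto
  qed
  then have "card {y \<in> U. y < x} = n"
    using strict_mono_enumerate[OF assms(1)]
    by (simp add: card_image strict_mono_imp_inj_on inj_on_subset)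
  then show ?thesis using n by simp
qed

lemma card_less_nth_sorted_list_of_set:
  fixes A :: "nat set"
  assumes "finite A" "i < card A"
  shows "card {y \<in> A. y < sorted_list_of_set A ! i} = i"
proof -
  let ?xs = "sorted_list_of_set A"
  have len: "length ?xs = card A" by simp
  have lt: "?xs ! k < ?xs ! i \<longleftrightarrow> k < i" if "k < card A" for k
    using that assms(2) sorted_wrt_nth_less[OF strict_sorted_list_of_set[of A]] len
    by (metis less_asym nat_neq_iff)
  have "{y \<in> A. y < ?xs ! i} = (!) ?xs ` {..<i}"
  proof (intro set_eqI iffI)
    fix y assume y: "y \<in> {y \<in> A. y < ?xs ! i}"
    then have "y \<in> set ?xs" using assms(1) by simp
    then obtain k where "k < card A" "y = ?xs ! k" by (metis in_set_conv_nth len)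
    then show "y \<in> (!) ?xs ` {..<i}" using y lt by auto
  next
    fix y assume "y \<in> (!) ?xs ` {..<i}"
    then obtain k where k: "k < i" "y = ?xs ! k" by auto
    then have "y \<in> A" using assms nth_mem[of k ?xs] by simp
    then show "y \<in> {y \<in> A. y < ?xs ! i}" using k lt assms(2) by simp
  qed
  moreover have "inj_on ((!) ?xs) {..<i}"
    using assms(2) by (intro inj_on_nth) auto
  ultimately show ?thesis by (simp add: card_image)
qed

text \<open>The embedding enumerates the union of all blocks. Below entry \<open>i\<close> of
  \<open>G j\<close> lie exactly the earlier blocks and \<open>i\<close> elements of
  \<open>G j\<close>, which is the position that \<open>concat_subseq\<close> prescribes.\<close>

lemma concat_subseq_blocks:
  assumes "blocks G"
  shows "concat_subseq (\<lambda>j. map b (sorted_list_of_set (G j))) b"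
proof -
  define U where "U = (\<Union>j. G j)"
  have "infinite U"
    unfolding infinite_nat_iff_unbounded_le
  proof
    fix m
    obtain x where "x \<in> G m" using blocks_nonempty[OF assms] by blast
    then show "\<exists>n\<ge>m. n \<in> U" using blocks_ge[OF assms] by (auto simp: U_def)
  qed
  have pos: "enumerate U ((\<Sum>l<j. card (G l)) + i) = sorted_list_of_set (G j) ! i"
    if i: "i < card (G j)" for i j
  proof -
    let ?x = "sorted_list_of_set (G j) ! i"
    have x: "?x \<in> G j"
      using i nth_mem[of i "sorted_list_of_set (G j)"] blocks_finite[OF assms] by simp
    have "{y \<in> U. y < ?x} = (\<Union>l<j. G l) \<union> {y \<in> G j. y < ?x}"
    proof (intro set_eqI iffI)
      fix y assume "y \<in> {y \<in> U. y < ?x}"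
      then obtain l where l: "y \<in> G l" "y < ?x" by (auto simp: U_def)
      then have "l \<le> j" using blocks_less[OF assms, of j l ?x y] x by (meson leI less_asym)
      then show "y \<in> (\<Union>l<j. G l) \<union> {y \<in> G j. y < ?x}" using l by (cases "l = j") auto
    next
      fix y assume "y \<in> (\<Union>l<j. G l) \<union> {y \<in> G j. y < ?x}"
      then show "y \<in> {y \<in> U. y < ?x}" using blocks_less[OF assms _ _ x] by (auto simp: U_def)
    qed
    moreover have "(\<Union>l<j. G l) \<inter> {y \<in> G j. y < ?x} = {}"
      using blocks_less[OF assms, of _ j] by blast
    then have "card ((\<Union>l<j. G l) \<union> {y \<in> G j. y < ?x})
        = card (\<Union>l<j. G l) + card {y \<in> G j. y < ?x}"
      using blocks_finite[OF assms] by (intro card_Un_disjoint) auto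
    moreover have "card (\<Union>l<j. G l) = (\<Sum>l<j. card (G l))"
      using blocks_finite[OF assms] blocks_disjoint[OF assms] by (intro card_UN_disjoint) auto
    moreover have "card {y \<in> G j. y < ?x} = i"
      using card_less_nth_sorted_list_of_set[OF blocks_finite[OF assms] i] .
    ultimately have "card {y \<in> U. y < ?x} = (\<Sum>l<j. card (G l)) + i" by simp
    then show ?thesis using enumerate_card_less[OF \<open>infinite U\<close>, of ?x] x by (auto simp: U_def)
  qed
  then show ?thesis
    unfolding concat_subseq_def
    using strict_mono_enumerate[OF \<open>infinite U\<close>] by (intro exI[of _ "enumerate U"]) simp
qed

section \<open>From finite unions to the Ramsey property\<close>

theorem theorem7p5:
  fixes scale :: "bit \<Rightarrow> 'v::ab_group_add \<Rightarrow> 'v"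
  assumes "vector_space scale"
  shows "ramsey_algebra (vector_space_ops scale)"
  unfolding ramsey_algebra_def
proof (intro allI)
  fix b :: "nat \<Rightarrow> 'v" and X :: "'v set"
  \<comment> \<open>Hindman's theorem is applied to the preimage of \<open>X\<close> under the map
    from index sets to sums of \<open>b\<close>.\<close>
  obtain G where G: "blocks G"
    "FU G \<subseteq> {S. sum b S \<in> X} \<or> FU G \<inter> {S. sum b S \<in> X} = {}"
    using Hindman_finite_unions by blast
  define a where "a j = sum b (G j)" for j
  define bs where "bs j = map b (sorted_list_of_set (G j))" for j
  have card_G: "card (G j) > 0" for j
    using blocks_finite[OF G(1)] blocks_nonempty[OF G(1)] by (simp add: card_gt_0_iff)
  have "\<exists>f. (card (G j), f) \<in> orderly_terms (vector_space_ops scale)" for j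
    using orderly_term_exists[of "card (G j) - 1" scale] card_G[of j] by simp
  then obtain f where f: "\<And>j. (card (G j), f j) \<in> orderly_terms (vector_space_ops scale)"
    by metis
  have "sum_list (bs j) = a j" for j
    using blocks_finite[OF G(1)] by (simp add: bs_def a_def sum_list_distinct_conv_sum_set)
  then have "a j = f j (bs j)" for j
    using orderly_term_sum_list[OF assms f, of j] by (simp add: bs_def)
  moreover have "finite_subseq (bs j) b" for j
    unfolding finite_subseq_def bs_def by (intro exI[of _ "sorted_list_of_set (G j)"]) simp
  moreover have "concat_subseq bs b"
    unfolding bs_def by (rule concat_subseq_blocks[OF G(1)])
  ultimately have "reduction (vector_space_ops scale) a b"
    unfolding reduction_def using f
    by (intro exI[of _ "\<lambda>j. card (G j)"] exI[of _ f] exI[of _ bs]) (simp add: bs_def)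
  moreover have "\<exists>S\<in>FU G. v = sum b S" if v: "v \<in> FR (vector_space_ops scale) a" for v
  proof -
    obtain n g ts where g: "v = g ts" "(n, g) \<in> orderly_terms (vector_space_ops scale)"
      "finite_subseq ts a" "length ts = n"
      using v by (auto simp: FR_def)
    obtain ks where ks: "sorted_wrt (<) ks" "ts = map a ks"
      using g(3) by (auto simp: finite_subseq_def)
    have n: "n \<ge> 1" "v = sum_list ts"
      using orderly_term_sum_list[OF assms g(2)] g(1,4) by auto
    then have "v = (\<Sum>k\<in>set ks. a k)"
      using ks by (simp add: sum_list_distinct_conv_sum_set strict_sorted_iff)
    \<comment> \<open>Disjointness of the blocks merges the double sum into a single sum over their
      union.\<close>
    also have "\<dots> = sum b (\<Union>(G ` set ks))"
      unfolding a_def using blocks_finite[OF G(1)] blocks_disjoint[OF G(1)]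
      by (intro sum.UNION_disjoint[symmetric]) auto
    finally have "v = sum b (\<Union>(G ` set ks))" .
    moreover have "set ks \<noteq> {}" using n(1) g(4) ks(2) by auto
    ultimately show ?thesis using FU_I[of "set ks" G] by auto
  qed
  then have "FR (vector_space_ops scale) a \<subseteq> X \<or> FR (vector_space_ops scale) a \<inter> X = {}"
    using G(2) by blast
  ultimately show "\<exists>a. reduction (vector_space_ops scale) a b \<and>
      (FR (vector_space_ops scale) a \<subseteq> X \<or> FR (vector_space_ops scale) a \<inter> X = {})"
    by blast
qed

end
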